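(* Let $\rho,\kappa>-1$ be real numbers, $m\ge0$ an integer and $n$ an integer with $n+\rho\ge0$. Then, for $z\in\mathbb{D}^*$, $$\mathcal{Z}^{\kappa,\rho}_{m,n}(z,\bar z)=\sum_{j=0}^{m\wedge^*(n+\rho)}\frac{(-1)^j\,m!\,\Gamma(n+\rho+1)\,\Gamma(\kappa+m+1)}{j!\,(m-j)!\,\Gamma(n+\rho-j+1)\,\Gamma(\kappa+j+1)}\,(1-|z|^2)^j z^{n-j}\bar z^{m-j}.$$
   Context: Let $\mathbb{D}=\{z\in\mathbb{C}:|z|<1\}$ and $\mathbb{D}^*=\mathbb{D}\setminus\{0\}$; $\partial/\partial z$ is the Wirtinger derivative. For reals $\rho,\kappa>-1$ and integers $m\ge0$, $n$ with $n+\rho\ge0$, the fractional Zernike function on $\mathbb{D}^*$ is $$\mathcal{Z}^{\kappa,\rho}_{m,n}(z,\bar z)=(-1)^m z^{-\rho}(1-|z|^2)^{-\kappa}\frac{\partial^m}{\partial z^m}\Big(z^{n+\rho}(1-|z|^2)^{\kappa+m}\Big),$$ the powers $z^{-\rho}$ and $z^{n+\rho}$ being taken with the same local branch (the result does not depend on the choice). For real $b$ and integer $m\ge0$: $m\wedge^*b=\min(m,b)$ if $b\in\{0,1,2,\dots\}$, and $m\wedge^* b=m$ otherwise. *)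

theory Defs
  imports "HOL-Analysis.Analysis"
begin

definition wirtinger :: "(complex \<Rightarrow> complex) \<Rightarrow> complex \<Rightarrow> complex" where
  "wirtinger f z =
     (vector_derivative (\<lambda>t::real. f (z + of_real t)) (at 0)
      - \<i> * vector_derivative (\<lambda>t::real. f (z + \<i> * of_real t)) (at 0)) / 2"

definition log_branch :: "complex set \<Rightarrow> (complex \<Rightarrow> complex) \<Rightarrow> bool" where
  "log_branch U L \<longleftrightarrow> open U \<and> continuous_on U L \<and> (\<forall>w\<in>U. exp (L w) = w)"

lemma log_branch_exists:
  assumes "z \<noteq> 0"
  shows "\<exists>U L. z \<in> U \<and> log_branch U L"
proof -
  define L where "L w = Ln (w / z) + Ln z" for w
  have nonneg: "w / z \<notin> \<real>\<^sub>\<le>\<^sub>0 \<and> w \<noteq> 0" if "w \<in> ball z (norm z)" for w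
  proof -
    have "norm (1 - w / z) = norm (z - w) / norm z"
      using assms by (simp add: diff_divide_distrib flip: norm_divide)
    also have "\<dots> < 1"
      using that assms by (simp add: dist_norm)
    finally have "norm (1 - w / z) < 1" .
    then have "Re (w / z) > 0"
      using complex_Re_le_cmod[of "1 - w / z"] by simp
    then show ?thesis
      by (auto simp: complex_nonpos_Reals_iff)
  qed
  have "continuous_on (ball z (norm z)) L"
    unfolding L_def by (intro continuous_intros) (use nonneg assms in auto)
  moreover have "\<forall>w\<in>ball z (norm z). exp (L w) = w"
    using nonneg assms by (auto simp: L_def exp_add)
  ultimately show ?thesis
    using assms unfolding log_branch_def by (intro exI[of _ "ball z (norm z)"] exI[of _ L]) auto
qed

text \<open>
  Here \<open>L\<close> is a branch of the logarithm near the evaluation point, and both complex powers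
  are taken with this branch, \<open>w\<^sup>a = exp (a L(w))\<close>. A single global choice such as the
  principal branch would be discontinuous on the negative real axis, where the derivative
  would then be meaningless.
\<close>

definition frac_Zernike ::
    "(complex \<Rightarrow> complex) \<Rightarrow> real \<Rightarrow> real \<Rightarrow> nat \<Rightarrow> int \<Rightarrow> complex \<Rightarrow> complex" where
  "frac_Zernike L \<kappa> \<rho> m n z =
     (-1) ^ m * exp (- of_real \<rho> * L z) * of_real ((1 - (cmod z)\<^sup>2) powr (- \<kappa>)) *
     (wirtinger ^^ m)
       (\<lambda>w. exp (of_real (of_int n + \<rho>) * L w) * of_real ((1 - (cmod w)\<^sup>2) powr (\<kappa> + of_nat m))) z"

definition min_star :: "nat \<Rightarrow> real \<Rightarrow> nat" where
  "min_star m b = (if b \<in> \<nat> then min m (nat \<lfloor>b\<rfloor>) else m)"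

end

theory Submission
  imports Defs
begin

text \<open>
  Write \<open>a = n + \<rho>\<close>, \<open>c = \<kappa> + m\<close> and \<open>x = 1 - \<bar>z\<bar>\<^sup>2\<close>. The formula is Leibniz' rule for the
  \<open>m\<close>-th Wirtinger derivative of the product \<open>z\<^sup>a x\<^sup>c\<close>. Both factors have Wirtinger derivatives
  of all orders in closed form: \<open>\<partial>/\<partial>z\<close> lowers the exponent of \<open>z\<^sup>a\<close>, whatever the
  branch, and because \<open>\<partial>x/\<partial>z = - cnj z\<close> is itself annihilated by \<open>\<partial>/\<partial>z\<close>, the
  \<open>i\<close>-th derivative of \<open>x\<^sup>c\<close> is
  \<open>c (c - 1) \<cdots> (c - i + 1) (- cnj z)\<^sup>i x\<^bsup>c - i\<^esup>\<close>.

  The prefactor \<open>z\<^bsup>-\<rho>\<^esup> x\<^bsup>-\<kappa>\<^esup>\<close> turns the remaining powers into the integral powers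
  \<open>z\<^bsup>n - j\<^esup>\<close> and \<open>x\<^sup>j\<close>; in particular the branch of the logarithm disappears. The falling
  factorials are quotients of Gamma values, except that \<open>a (a - 1) \<cdots> (a - j + 1)\<close> vanishes
  if \<open>a\<close> is a natural number below \<open>j\<close>, which is where the Leibniz sum is cut off.

  The iterated operator only makes sense near \<open>z\<close>, so all derivatives are computed on an open set
  on which the branch is defined.
\<close>

section \<open>Wirtinger derivatives of real differentiable functions\<close>

text \<open>
  Every real-linear map \<open>\<complex> \<rightarrow> \<complex>\<close> has the form \<open>h \<mapsto> p h + q (cnj h)\<close>, and for the
  derivative of \<open>f\<close> the coefficient \<open>p\<close> is the Wirtinger derivative. Unlike the defining expression
  in terms of two partial derivatives, this notion includes total differentiability and therefore
  satisfies the product rule without side conditions.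
\<close>

definition has_wirtinger :: "(complex \<Rightarrow> complex) \<Rightarrow> complex \<Rightarrow> complex \<Rightarrow> bool" where
  "has_wirtinger f p w \<longleftrightarrow> (\<exists>q. (f has_derivative (\<lambda>h. p * h + q * cnj h)) (at w))"

lemma wirtinger_eqI:
  assumes "has_wirtinger f p w"
  shows "wirtinger f w = p"
proof -
  obtain q where q: "(f has_derivative (\<lambda>h. p * h + q * cnj h)) (at w)"
    using assms by (auto simp: has_wirtinger_def)
  have along: "vector_derivative (\<lambda>t::real. f (w + u * of_real t)) (at 0) = p * u + q * cnj u" for u
  proof -
    have "((\<lambda>t::real. w + u * of_real t) has_derivative (\<lambda>t. u * of_real t)) (at 0)"
      by (auto intro!: derivative_eq_intros)
    from has_derivative_compose[OF this, of f "\<lambda>h. p * h + q * cnj h"] q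
    have "((\<lambda>t::real. f (w + u * of_real t)) has_derivative
            (\<lambda>t. p * (u * of_real t) + q * cnj (u * of_real t))) (at 0)"
      by simp
    then have "((\<lambda>t::real. f (w + u * of_real t)) has_vector_derivative p * u + q * cnj u) (at 0)"
      by (simp add: has_vector_derivative_def scaleR_conv_of_real algebra_simps)
    then show ?thesis
      by (rule vector_derivative_at)
  qed
  have "\<i> * (p * \<i> + q * cnj \<i>) = q - p"
    by (simp add: algebra_simps)
  then show ?thesis
    using along[of 1] along[of \<i>] by (simp add: wirtinger_def)
qed

lemma has_wirtinger_transform:
  assumes "has_wirtinger f p w" and "open V" and "w \<in> V" and "\<And>v. v \<in> V \<Longrightarrow> f v = g v"
  shows "has_wirtinger g p w"
proof -
  obtain q where "(f has_derivative (\<lambda>h. p * h + q * cnj h)) (at w)"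
    using assms(1) by (auto simp: has_wirtinger_def)
  from has_derivative_transform_within_open[OF this assms(2-4)] show ?thesis
    unfolding has_wirtinger_def by blast
qed

lemma has_wirtinger_mult:
  assumes "has_wirtinger f p w" and "has_wirtinger g p' w"
  shows "has_wirtinger (\<lambda>v. f v * g v) (p * g w + f w * p') w"
proof -
  obtain q q' where
    "(f has_derivative (\<lambda>h. p * h + q * cnj h)) (at w)"
    "(g has_derivative (\<lambda>h. p' * h + q' * cnj h)) (at w)"
    using assms by (auto simp: has_wirtinger_def)
  from has_derivative_mult[OF this]
  have "((\<lambda>v. f v * g v) has_derivative
          (\<lambda>h. (p * g w + f w * p') * h + (q * g w + f w * q') * cnj h)) (at w)"
    by (simp add: algebra_simps)
  then show ?thesis
    unfolding has_wirtinger_def by blast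
qed

lemma has_wirtinger_const: "has_wirtinger (\<lambda>v. k) 0 w"
  unfolding has_wirtinger_def by (intro exI[of _ 0]) simp

lemma has_wirtinger_cmult:
  assumes "has_wirtinger f p w"
  shows "has_wirtinger (\<lambda>v. k * f v) (k * p) w"
  using has_wirtinger_mult[OF has_wirtinger_const assms] by simp

lemma has_wirtinger_add:
  assumes "has_wirtinger f p w" and "has_wirtinger g p' w"
  shows "has_wirtinger (\<lambda>v. f v + g v) (p + p') w"
proof -
  obtain q q' where
    "(f has_derivative (\<lambda>h. p * h + q * cnj h)) (at w)"
    "(g has_derivative (\<lambda>h. p' * h + q' * cnj h)) (at w)"
    using assms by (auto simp: has_wirtinger_def)
  from has_derivative_add[OF this]
  have "((\<lambda>v. f v + g v) has_derivative (\<lambda>h. (p + p') * h + (q + q') * cnj h)) (at w)"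
    by (simp add: algebra_simps)
  then show ?thesis
    unfolding has_wirtinger_def by blast
qed

lemma has_wirtinger_sum:
  assumes "\<And>i. i \<in> I \<Longrightarrow> has_wirtinger (f i) (p i) w"
  shows "has_wirtinger (\<lambda>v. \<Sum>i\<in>I. f i v) (\<Sum>i\<in>I. p i) w"
  using assms
  by (induction I rule: infinite_finite_induct)
     (auto intro: has_wirtinger_const has_wirtinger_add)

lemma has_wirtinger_holomorphic:
  assumes "(f has_field_derivative p) (at w)"
  shows "has_wirtinger f p w"
  using assms unfolding has_wirtinger_def has_field_derivative_def
  by (intro exI[of _ 0]) simp

lemma has_wirtinger_cnj_power: "has_wirtinger (\<lambda>v. (- cnj v) ^ i) 0 w"
proof (induction i)
  case 0
  show ?case by (simp add: has_wirtinger_const)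
next
  case (Suc i)
  have "((\<lambda>v. - cnj v) has_derivative (\<lambda>h. 0 * h + (- 1) * cnj h)) (at w)"
    by (auto intro!: derivative_eq_intros)
  then have "has_wirtinger (\<lambda>v. - cnj v) 0 w"
    unfolding has_wirtinger_def by blast
  from has_wirtinger_mult[OF this Suc] show ?case by simp
qed

section \<open>The Leibniz rule\<close>

text \<open>
  As for the one-variable rule, the step is Pascal's identity. Since differentiating once more
  requires the formula near the point, the induction runs over all points of an open set.
\<close>

lemma wirtinger_funpow_mult:
  assumes "open V"
    and g: "\<And>j v. v \<in> V \<Longrightarrow> has_wirtinger (g j) (g (Suc j) v) v"
    and h: "\<And>i v. v \<in> V \<Longrightarrow> has_wirtinger (h i) (h (Suc i) v) v"
    and "w \<in> V"
  shows "(wirtinger ^^ k) (\<lambda>v. g 0 v * h 0 v) w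
           = (\<Sum>j\<le>k. of_nat (k choose j) * (g j w * h (k - j) w))"
  using \<open>w \<in> V\<close>
proof (induction k arbitrary: w)
  case 0
  show ?case by simp
next
  case (Suc k)
  let ?S = "\<lambda>v. \<Sum>j\<le>k. of_nat (k choose j) * (g j v * h (k - j) v)"
  let ?D = "\<Sum>j\<le>k. of_nat (k choose j) * (g (Suc j) w * h (k - j) w + g j w * h (Suc (k - j)) w)"
  have "has_wirtinger ?S ?D w"
    by (intro has_wirtinger_sum has_wirtinger_cmult has_wirtinger_mult g h Suc.prems)
  then have "has_wirtinger ((wirtinger ^^ k) (\<lambda>v. g 0 v * h 0 v)) ?D w"
    by (rule has_wirtinger_transform[OF _ \<open>open V\<close> Suc.prems]) (simp add: Suc.IH)
  then have "(wirtinger ^^ Suc k) (\<lambda>v. g 0 v * h 0 v) w = ?D"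
    by (simp add: wirtinger_eqI)
  also have "?D = (\<Sum>j\<le>k. of_nat (k choose j) * (g (Suc j) w * h (k - j) w))
                 + (\<Sum>j\<le>k. of_nat (k choose j) * (g j w * h (Suc k - j) w))"
    by (simp add: sum.distrib algebra_simps Suc_diff_le)
  also have "(\<Sum>j\<le>k. of_nat (k choose j) * (g j w * h (Suc k - j) w))
      = (\<Sum>j\<le>Suc k. of_nat (k choose j) * (g j w * h (Suc k - j) w))"
    by simp
  also have "\<dots> = g 0 w * h (Suc k) w
      + (\<Sum>j\<le>k. of_nat (k choose Suc j) * (g (Suc j) w * h (k - j) w))"
    by (subst sum.atMost_Suc_shift) simp
  also have "(\<Sum>j\<le>k. of_nat (k choose j) * (g (Suc j) w * h (k - j) w)) + \<dots>
      = (\<Sum>j\<le>Suc k. of_nat (Suc k choose j) * (g j w * h (Suc k - j) w))"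
    by (subst sum.atMost_Suc_shift) (simp add: sum.distrib algebra_simps)
  finally show ?case .
qed

section \<open>Derivatives of the two factors\<close>

lemma log_branch_has_field_derivative:
  assumes "log_branch U L" and "w \<in> U"
  shows "(L has_field_derivative inverse w) (at w)"
proof -
  have U: "open U" "continuous_on U L" "\<And>v. v \<in> U \<Longrightarrow> exp (L v) = v"
    using assms by (auto simp: log_branch_def)
  have "(exp has_field_derivative w) (at (L w))"
    using DERIV_exp[of "L w"] U(3) assms(2) by simp
  moreover have "w \<noteq> 0"
    using U(3)[OF assms(2)] by (metis exp_not_eq_zero)
  moreover have "isCont L w"
    using U assms(2) by (simp add: continuous_on_eq_continuous_at)
  ultimately show ?thesis
    using U assms(2) by (intro has_field_derivative_inverse_basic[where f = exp and t = U]) auto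
qed

text \<open>
  The falling factorial \<open>a (a - 1) \<cdots> (a - j + 1)\<close> is written as the rising factorial
  \<open>pochhammer (a - j + 1) j\<close>, for which the relation to the Gamma function and the zeros
  are known.
\<close>

lemma pochhammer_falling_Suc:
  fixes a :: real
  shows "pochhammer (a - real (Suc j) + 1) (Suc j) = (a - real j) * pochhammer (a - real j + 1) j"
  by (simp add: pochhammer_rec)

lemma has_wirtinger_branch_power:
  fixes a :: real
  assumes "log_branch U L" and "w \<in> U"
  shows "has_wirtinger
    (\<lambda>v. of_real (pochhammer (a - real j + 1) j) * exp (of_real (a - real j) * L v))
    (of_real (pochhammer (a - real (Suc j) + 1) (Suc j)) * exp (of_real (a - real (Suc j)) * L w)) w"
proof -
  have e: "exp (L w) = w"
    using assms by (simp add: log_branch_def)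
  have "((\<lambda>v. exp (of_real (a - real j) * L v)) has_field_derivative
          exp (of_real (a - real j) * L w) * (of_real (a - real j) * inverse w)) (at w)"
    by (auto intro!: derivative_eq_intros log_branch_has_field_derivative[OF assms])
  also have "exp (of_real (a - real j) * L w) * (of_real (a - real j) * inverse w)
      = of_real (a - real j) * exp (of_real (a - real (Suc j)) * L w)"
  proof -
    have "exp (of_real (a - real (Suc j)) * L w) = exp (of_real (a - real j) * L w - L w)"
      by (simp add: algebra_simps)
    then show ?thesis
      unfolding exp_diff e by (simp add: field_simps)
  qed
  finally have "has_wirtinger (\<lambda>v. exp (of_real (a - real j) * L v))
      (of_real (a - real j) * exp (of_real (a - real (Suc j)) * L w)) w"
    by (rule has_wirtinger_holomorphic)
  from has_wirtinger_cmult[OF this, of "of_real (pochhammer (a - real j + 1) j)"]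
  show ?thesis
    unfolding pochhammer_falling_Suc by (simp add: mult_ac)
qed

lemma has_wirtinger_disc_powr:
  assumes "cmod w < 1"
  shows "has_wirtinger (\<lambda>v. of_real ((1 - (cmod v)\<^sup>2) powr s))
           (of_real s * (- cnj w) * of_real ((1 - (cmod w)\<^sup>2) powr (s - 1))) w"
proof -
  have pos: "1 - (cmod w)\<^sup>2 > 0"
    using assms by (simp add: power_less_one_iff abs_square_less_1)
  have sq: "(cmod v)\<^sup>2 = v \<bullet> v" for v
    by (simp add: power2_norm_eq_inner)
  have "((\<lambda>v. 1 - v \<bullet> v) has_derivative (\<lambda>h. - (2 * (w \<bullet> h)))) (at w)"
    by (auto intro!: derivative_eq_intros simp: inner_commute)
  moreover have "((\<lambda>t. t powr s) has_derivative (\<lambda>t. s * (1 - w \<bullet> w) powr (s - 1) * t))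
                   (at (1 - w \<bullet> w))"
    using has_real_derivative_powr[of "1 - w \<bullet> w" s] pos
    unfolding has_field_derivative_def sq by simp
  ultimately have "((\<lambda>v. (1 - v \<bullet> v) powr s) has_derivative
      (\<lambda>h. s * (1 - w \<bullet> w) powr (s - 1) * (- (2 * (w \<bullet> h))))) (at w)"
    by (rule has_derivative_compose)
  then have "((\<lambda>v. complex_of_real ((1 - v \<bullet> v) powr s)) has_derivative
      (\<lambda>h. of_real (s * (1 - w \<bullet> w) powr (s - 1) * (- (2 * (w \<bullet> h)))))) (at w)"
    by (rule has_derivative_of_real)
  moreover have "complex_of_real (s * (1 - w \<bullet> w) powr (s - 1) * (- (2 * (w \<bullet> h))))
      = (of_real s * (- cnj w) * of_real ((1 - w \<bullet> w) powr (s - 1))) * h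
          + (of_real s * (- w) * of_real ((1 - w \<bullet> w) powr (s - 1))) * cnj h" for h
  proof -
    have "complex_of_real (2 * (w \<bullet> h)) = cnj w * h + w * cnj h"
      by (simp add: complex_eq_iff inner_complex_def)
    then show ?thesis
      unfolding of_real_mult[of "s * _"] of_real_mult[of s] of_real_minus
      by (simp only:) (simp add: algebra_simps)
  qed
  ultimately have "((\<lambda>v. complex_of_real ((1 - (cmod v)\<^sup>2) powr s)) has_derivative
      (\<lambda>h. (of_real s * (- cnj w) * of_real ((1 - (cmod w)\<^sup>2) powr (s - 1))) * h
          + (of_real s * (- w) * of_real ((1 - (cmod w)\<^sup>2) powr (s - 1))) * cnj h)) (at w)"
    unfolding sq by (simp only:)
  then show ?thesis
    unfolding has_wirtinger_def by blast
qed

text \<open>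
  Only the power of \<open>1 - \<bar>w\<bar>\<^sup>2\<close> contributes: the antiholomorphic factor \<open>(- cnj w)\<^sup>i\<close> behaves like a
  constant.
\<close>

lemma has_wirtinger_disc_powr_chain:
  fixes c :: real
  assumes "cmod w < 1"
  shows "has_wirtinger
    (\<lambda>v. of_real (pochhammer (c - real i + 1) i) *
           ((- cnj v) ^ i * of_real ((1 - (cmod v)\<^sup>2) powr (c - real i))))
    (of_real (pochhammer (c - real (Suc i) + 1) (Suc i)) *
       ((- cnj w) ^ Suc i * of_real ((1 - (cmod w)\<^sup>2) powr (c - real (Suc i))))) w"
proof -
  have "c - real i - 1 = c - real (Suc i)"
    by simp
  then show ?thesis
    using has_wirtinger_cmult[OF has_wirtinger_mult[OF has_wirtinger_cnj_power
        has_wirtinger_disc_powr[OF assms]], of "of_real (pochhammer (c - real i + 1) i)" i "c - real i"]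
    unfolding pochhammer_falling_Suc by (simp only: of_real_mult power_Suc mult_zero_left add_0_left mult_ac)
qed

section \<open>Coefficients\<close>

lemma pochhammer_falling_Gamma:
  fixes a :: real
  assumes "a - real j + 1 \<notin> \<int>\<^sub>\<le>\<^sub>0"
  shows "pochhammer (a - real j + 1) j = Gamma (a + 1) / Gamma (a - real j + 1)"
  using pochhammer_Gamma[OF assms, of j] by simp

text \<open>
  The quotient formula fails where \<open>\<Gamma> (a - j + 1)\<close> has a pole, which for \<open>a \<ge> 0\<close> happens exactly when
  \<open>a\<close> is a natural number below \<open>j\<close>; the upper limit \<open>min_star m a\<close> excludes such \<open>j\<close>.
\<close>

lemma not_nonpos_Int_within_min_star:
  assumes "a \<ge> 0" and "j \<le> min_star m a"
  shows "a - real j + 1 \<notin> \<int>\<^sub>\<le>\<^sub>0"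
proof
  assume "a - real j + 1 \<in> \<int>\<^sub>\<le>\<^sub>0"
  then obtain k where k: "a - real j + 1 = - real k"
    by (auto elim!: nonpos_Ints_cases')
  then have "a = real_of_int (int j - 1 - int k)"
    by simp
  with \<open>a \<ge> 0\<close> obtain l where l: "a = real l"
    by (metis of_int_0_le_iff nonneg_int_cases of_int_of_nat_eq)
  with assms(2) have "j \<le> l"
    by (simp add: min_star_def)
  with k l show False
    by simp
qed

lemma pochhammer_falling_beyond_min_star:
  assumes "j \<le> m" and "\<not> j \<le> min_star m a"
  shows "pochhammer (a - real j + 1) j = 0"
proof -
  obtain l where l: "a = real l"
    using assms by (auto simp: min_star_def Nats_def split: if_splits)
  with assms have "l < j"
    by (auto simp: min_star_def)
  with l have "a - real j + 1 = - real (j - 1 - l)" and "j - 1 - l < j"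
    by auto
  then show ?thesis
    using pochhammer_of_nat_eq_0_lemma by metis
qed

section \<open>The explicit formula\<close>

theorem proposition3p3:
  fixes \<rho> \<kappa> :: real and m :: nat and n :: int and z :: complex
    and U :: "complex set" and L :: "complex \<Rightarrow> complex"
  assumes "\<rho> > -1" and "\<kappa> > -1" and "of_int n + \<rho> \<ge> 0"
    and "z \<noteq> 0" and "cmod z < 1"
    and "log_branch U L" and "z \<in> U"
  shows "frac_Zernike L \<kappa> \<rho> m n z =
    (\<Sum>j = 0..min_star m (of_int n + \<rho>).
       of_real ((-1) ^ j * fact m * Gamma (of_int n + \<rho> + 1) * Gamma (\<kappa> + of_nat m + 1) /
         (fact j * fact (m - j) * Gamma (of_int n + \<rho> - of_nat j + 1) * Gamma (\<kappa> + of_nat j + 1)))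
       * of_real ((1 - (cmod z)\<^sup>2) ^ j) * z powi (n - int j) * cnj z ^ (m - j))"
proof -
  define a where "a = of_int n + \<rho>"
  define c where "c = \<kappa> + real m"
  define x where "x = 1 - (cmod z)\<^sup>2"
  define P where "P b j = pochhammer (b - real j + 1) j" for b :: real and j
  define g where "g j v = complex_of_real (P a j) * exp (of_real (a - real j) * L v)" for j v
  define h where "h i v = complex_of_real (P c i) *
      ((- cnj v) ^ i * of_real ((1 - (cmod v)\<^sup>2) powr (c - real i)))" for i v
  \<comment> \<open>the branch is differentiable on \<open>U\<close>, and on the disc the base \<open>1 - \<bar>v\<bar>\<^sup>2\<close> is positive\<close>
  define V where "V = U \<inter> ball 0 1"
  have V: "open V" "z \<in> V"
    using assms by (auto simp: V_def log_branch_def)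
  have x: "x > 0"
    using assms(5) by (simp add: x_def abs_square_less_1)
  have z: "exp (L z) = z"
    using assms by (simp add: log_branch_def)
  have leibniz: "(wirtinger ^^ m) (\<lambda>v. g 0 v * h 0 v) z
      = (\<Sum>j\<le>m. of_nat (m choose j) * (g j z * h (m - j) z))"
  proof (rule wirtinger_funpow_mult[OF V(1) _ _ V(2)])
    show "has_wirtinger (g j) (g (Suc j) v) v" if "v \<in> V" for j v
      using has_wirtinger_branch_power[OF assms(6), of v a j] that
      unfolding g_def P_def V_def by blast
    show "has_wirtinger (h i) (h (Suc i) v) v" if "v \<in> V" for i v
      using has_wirtinger_disc_powr_chain[of v c i] that
      unfolding h_def P_def V_def by auto
  qed
  have start: "(\<lambda>w. exp (of_real (of_int n + \<rho>) * L w) *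
      of_real ((1 - (cmod w)\<^sup>2) powr (\<kappa> + of_nat m))) = (\<lambda>v. g 0 v * h 0 v)"
    by (simp add: fun_eq_iff g_def h_def P_def a_def c_def)
  let ?pre = "(-1) ^ m * exp (- of_real \<rho> * L z) * of_real (x powr (- \<kappa>))"
  \<comment> \<open>the sign \<open>(-1)\<^sup>m\<close> meets the \<open>(-1)\<^bsup>m - j\<^esup>\<close> from the powers of \<open>- cnj z\<close> and leaves \<open>(-1)\<^sup>j\<close>\<close>
  have summand: "?pre * (of_nat (m choose j) * (g j z * h (m - j) z))
      = of_real ((-1) ^ j * of_nat (m choose j) * P a j * P c (m - j))
        * of_real (x ^ j) * z powi (n - int j) * cnj z ^ (m - j)" if "j \<le> m" for j
  proof -
    have "exp (- of_real \<rho> * L z) * exp (of_real (a - real j) * L z)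
        = exp (of_int (n - int j) * L z)"
      by (simp add: a_def algebra_simps flip: exp_add)
    also have "\<dots> = z powi (n - int j)"
      by (metis exp_power_int z)
    finally have Z: "exp (- of_real \<rho> * L z) * exp (of_real (a - real j) * L z)
        = z powi (n - int j)" .
    have "x powr (- \<kappa>) * x powr (c - real (m - j)) = x powr real j"
      using that by (simp add: c_def of_nat_diff flip: powr_add)
    also have "\<dots> = x ^ j"
      using x by (simp add: powr_realpow)
    finally have X: "complex_of_real (x powr (- \<kappa>)) * of_real (x powr (c - real (m - j)))
        = of_real (x ^ j)"
      by (metis of_real_mult)
    have S: "(-1) ^ m * (- cnj z) ^ (m - j) = (-1) ^ j * cnj z ^ (m - j)"
    proof -
      have "(-1) ^ m * (- cnj z) ^ (m - j)
          = ((-1) ^ j * (-1) ^ (m - j)) * ((-1) ^ (m - j) * cnj z ^ (m - j))"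
        using that by (simp add: power_minus[of "cnj z"] flip: power_add)
      then show ?thesis
        by (simp add: mult_ac flip: power_mult_distrib)
    qed
    have "?pre * (of_nat (m choose j) * (g j z * h (m - j) z))
      = of_nat (m choose j) * of_real (P a j) * of_real (P c (m - j))
        * ((-1) ^ m * (- cnj z) ^ (m - j))
        * (exp (- of_real \<rho> * L z) * exp (of_real (a - real j) * L z))
        * (of_real (x powr (- \<kappa>)) * of_real (x powr (c - real (m - j))))"
      unfolding g_def h_def x_def by (simp only: mult_ac)
    then show ?thesis
      unfolding Z X S by (simp add: mult_ac)
  qed
  \<comment> \<open>\<open>\<kappa> > -1\<close> keeps \<open>\<kappa> + j + 1\<close> away from the poles of \<open>\<Gamma>\<close>\<close>
  have coeff: "(-1) ^ j * of_nat (m choose j) * P a j * P c (m - j)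
      = (-1) ^ j * fact m * Gamma (a + 1) * Gamma (\<kappa> + of_nat m + 1) /
         (fact j * fact (m - j) * Gamma (a - of_nat j + 1) * Gamma (\<kappa> + of_nat j + 1))"
    if "j \<le> min_star m a" for j
  proof -
    have jm: "j \<le> m"
      using that by (auto simp: min_star_def split: if_splits)
    have "a \<ge> 0"
      using assms(3) by (simp add: a_def)
    then have A: "P a j = Gamma (a + 1) / Gamma (a - real j + 1)"
      unfolding P_def using that
      by (intro pochhammer_falling_Gamma not_nonpos_Int_within_min_star[where m = m])
    have c: "c - real (m - j) + 1 = \<kappa> + real j + 1"
      using jm by (simp add: c_def of_nat_diff)
    have "\<kappa> + real j + 1 > 0"
      using assms(2) by simp
    then have "c - real (m - j) + 1 \<notin> \<int>\<^sub>\<le>\<^sub>0"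
      unfolding c using nonpos_Ints_nonpos by fastforce
    from pochhammer_falling_Gamma[OF this]
    have C: "P c (m - j) = Gamma (\<kappa> + real m + 1) / Gamma (\<kappa> + real j + 1)"
      unfolding P_def c by (simp add: c_def)
    show ?thesis
      unfolding A C binomial_fact[OF jm] by simp
  qed
  have "frac_Zernike L \<kappa> \<rho> m n z
      = ?pre * (\<Sum>j\<le>m. of_nat (m choose j) * (g j z * h (m - j) z))"
    unfolding frac_Zernike_def start leibniz x_def ..
  also have "\<dots> = (\<Sum>j\<le>m. of_real ((-1) ^ j * of_nat (m choose j) * P a j * P c (m - j))
        * of_real (x ^ j) * z powi (n - int j) * cnj z ^ (m - j))"
    unfolding sum_distrib_left by (intro sum.cong refl summand) simp
  also have "\<dots> = (\<Sum>j = 0..min_star m a.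
        of_real ((-1) ^ j * of_nat (m choose j) * P a j * P c (m - j))
        * of_real (x ^ j) * z powi (n - int j) * cnj z ^ (m - j))"
  proof (rule sum.mono_neutral_right)
    show "{0..min_star m a} \<subseteq> {..m}"
      by (auto simp: min_star_def)
    have "P a j = 0" if "j \<in> {..m} - {0..min_star m a}" for j
      using that unfolding P_def by (intro pochhammer_falling_beyond_min_star[where m = m]) auto
    then show "\<forall>j\<in>{..m} - {0..min_star m a}.
        of_real ((-1) ^ j * of_nat (m choose j) * P a j * P c (m - j))
        * of_real (x ^ j) * z powi (n - int j) * cnj z ^ (m - j) = 0"
      by simp
  qed simp
  also have "\<dots> = (\<Sum>j = 0..min_star m a.
       of_real ((-1) ^ j * fact m * Gamma (a + 1) * Gamma (\<kappa> + of_nat m + 1) /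
         (fact j * fact (m - j) * Gamma (a - of_nat j + 1) * Gamma (\<kappa> + of_nat j + 1)))
       * of_real (x ^ j) * z powi (n - int j) * cnj z ^ (m - j))"
    by (intro sum.cong refl) (simp only: coeff atLeastAtMost_iff)
  finally show ?thesis
    unfolding a_def x_def .
qed

end
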